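(* Let $f:X\to Y$ be a continuous map between topological spaces, let $M,N$ be spatial MT-algebras, and let $h:N\to M$ be an MT-morphism. Then: (1) $(Y,f)$ is a compactification of the space $X$ if and only if $(\mathscr P(Y),f^{-1})$ is a compactification of the MT-algebra $\mathscr P(X)$; (2) $(N,h)$ is a compactification of the MT-algebra $M$ if and only if $(\mathrm{at}(N),\mathrm{at}(h))$ is a compactification of the space $\mathrm{at}(M)$.
   Context: A compactification of a topological space $X$ is a pair $(Y,f)$ where $Y$ is compact (no separation assumed), $f:X\to Y$ is a topological embedding, and $f(X)$ is dense in $Y$. An MT-algebra is a pair $(M,\square)$, where $M$ is a complete Boolean algebra and $\square:M\to M$ satisfies $\square 1=1$, $\square(a\wedge b)=\square a\wedge\square b$, $\square a\le a$, $\square a\le\square\square a$. An element $a$ is open if $a=\square a$; $\mathcal O(M)$ is the set (a frame) of open elements. An MT-morphism $h:N\to M$ is a complete Boolean homomorphism with $h(\square a)\le\square h(a)$ for all $a$; it restricts to a frame homomorphism $\mathcal O(h):\mathcal O(N)\to\mathcal O(M)$. $M$ is spatial if it is atomic as a Boolean algebra. $M$ is compact if whenever $\bigvee S=1$ with $S\subseteq\mathcal O(M)$, there is a finite $T\subseteq S$ with $\bigvee T=1$. An MT-morphism $h:N\to M$ is dense if $h(u)=0$ implies $u=0$ for every $u\in\mathcal O(N)$, and is an MT-embedding if both $h$ and $\mathcal O(h)$ are onto. A compactification of $M$ is a pair $(N,h)$ with $N$ a compact MT-algebra and $h:N\to M$ a dense MT-embedding. For a space $X$, $\mathscr P(X)$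 is the MT-algebra given by the powerset of $X$ with the topological interior operator; for continuous $f:X\to Y$, the inverse image $f^{-1}:\mathscr P(Y)\to\mathscr P(X)$ is an MT-morphism. For an MT-algebra $M$, $\mathrm{at}(M)$ is the set of atoms of $M$ with open sets $\{x\in\mathrm{at}(M)\mid x\le u\}$, $u\in\mathcal O(M)$. For an MT-morphism $h:N\to M$, $\mathrm{at}(h):\mathrm{at}(M)\to\mathrm{at}(N)$ is the continuous map obtained by restricting the left adjoint of $h$ to atoms, i.e. $\mathrm{at}(h)(x)=\bigwedge\{b\in N\mid x\le h(b)\}$. *)

theory Defs
  imports "HOL-Analysis.Abstract_Topology" "HOL-Algebra.Complete_Lattice"
begin

definition is_complement :: "('a, 'b) gorder_scheme \<Rightarrow> 'a \<Rightarrow> 'a \<Rightarrow> bool" where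
  "is_complement L x y \<longleftrightarrow> x \<in> carrier L \<and> y \<in> carrier L \<and>
     x \<sqinter>\<^bsub>L\<^esub> y = \<bottom>\<^bsub>L\<^esub> \<and> x \<squnion>\<^bsub>L\<^esub> y = \<top>\<^bsub>L\<^esub>"

text \<open>
  The type class \<^class>\<open>complete_boolean_algebra\<close> is not suitable here: it demands complete
  distributivity, which forces atomicity. Only binary distributivity is required below. The
  one-element algebra is allowed; it is the powerset of the empty space.
\<close>

locale complete_boolean_lattice = complete_lattice L for L (structure) +
  assumes meet_join_distrib:
      "\<lbrakk>x \<in> carrier L; y \<in> carrier L; z \<in> carrier L\<rbrakk>
       \<Longrightarrow> x \<sqinter> (y \<squnion> z) = (x \<sqinter> y) \<squnion> (x \<sqinter> z)"
    and complement_exists: "x \<in> carrier L \<Longrightarrow> \<exists>y. is_complement L x y"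

record 'a mt_struct = "'a gorder" +
  box :: "'a \<Rightarrow> 'a"  (\<open>\<box>\<index>_\<close> [81] 80)

locale mt_algebra = complete_boolean_lattice M for M (structure) +
  assumes box_closed: "a \<in> carrier M \<Longrightarrow> \<box> a \<in> carrier M"
    and box_top: "\<box> \<top> = \<top>"
    and box_meet: "\<lbrakk>a \<in> carrier M; b \<in> carrier M\<rbrakk> \<Longrightarrow> \<box> (a \<sqinter> b) = \<box> a \<sqinter> \<box> b"
    and box_le: "a \<in> carrier M \<Longrightarrow> \<box> a \<sqsubseteq> a"
    and box_le_box_box: "a \<in> carrier M \<Longrightarrow> \<box> a \<sqsubseteq> \<box> (\<box> a)"

definition opens :: "('a, 'b) mt_struct_scheme \<Rightarrow> 'a set" where
  "opens M = {a \<in> carrier M. a = \<box>\<^bsub>M\<^esub> a}"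

definition atoms :: "('a, 'b) gorder_scheme \<Rightarrow> 'a set" where
  "atoms L = {x \<in> carrier L. x \<noteq> \<bottom>\<^bsub>L\<^esub> \<and>
     (\<forall>y \<in> carrier L. y \<sqsubseteq>\<^bsub>L\<^esub> x \<longrightarrow> y = \<bottom>\<^bsub>L\<^esub> \<or> y = x)}"

definition atomic :: "('a, 'b) gorder_scheme \<Rightarrow> bool" where
  "atomic L \<longleftrightarrow> (\<forall>a \<in> carrier L. a \<noteq> \<bottom>\<^bsub>L\<^esub> \<longrightarrow> (\<exists>x \<in> atoms L. x \<sqsubseteq>\<^bsub>L\<^esub> a))"

definition spatial_mt_algebra :: "('a, 'b) mt_struct_scheme \<Rightarrow> bool" where
  "spatial_mt_algebra M \<longleftrightarrow> mt_algebra M \<and> atomic M"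

definition compact_mt_algebra :: "('a, 'b) mt_struct_scheme \<Rightarrow> bool" where
  "compact_mt_algebra M \<longleftrightarrow> mt_algebra M \<and>
     (\<forall>S \<subseteq> opens M. \<Squnion>\<^bsub>M\<^esub> S = \<top>\<^bsub>M\<^esub> \<longrightarrow>
        (\<exists>T. finite T \<and> T \<subseteq> S \<and> \<Squnion>\<^bsub>M\<^esub> T = \<top>\<^bsub>M\<^esub>))"

definition complete_boolean_hom ::
  "('a, 'c) gorder_scheme \<Rightarrow> ('b, 'd) gorder_scheme \<Rightarrow> ('a \<Rightarrow> 'b) \<Rightarrow> bool" where
  "complete_boolean_hom L K h \<longleftrightarrow>
     h \<in> carrier L \<rightarrow> carrier K \<and> sup_pres L K h \<and> inf_pres L K h \<and>
     (\<forall>a b. is_complement L a b \<longrightarrow> is_complement K (h a) (h b))"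

definition mt_morphism ::
  "('a, 'c) mt_struct_scheme \<Rightarrow> ('b, 'd) mt_struct_scheme \<Rightarrow> ('a \<Rightarrow> 'b) \<Rightarrow> bool" where
  "mt_morphism N M h \<longleftrightarrow> mt_algebra N \<and> mt_algebra M \<and> complete_boolean_hom N M h \<and>
     (\<forall>a \<in> carrier N. h (\<box>\<^bsub>N\<^esub> a) \<sqsubseteq>\<^bsub>M\<^esub> \<box>\<^bsub>M\<^esub> (h a))"

definition dense_mt_morphism ::
  "('a, 'c) mt_struct_scheme \<Rightarrow> ('b, 'd) mt_struct_scheme \<Rightarrow> ('a \<Rightarrow> 'b) \<Rightarrow> bool" where
  "dense_mt_morphism N M h \<longleftrightarrow> mt_morphism N M h \<and>
     (\<forall>u \<in> opens N. h u = \<bottom>\<^bsub>M\<^esub> \<longrightarrow> u = \<bottom>\<^bsub>N\<^esub>)"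

definition mt_embedding ::
  "('a, 'c) mt_struct_scheme \<Rightarrow> ('b, 'd) mt_struct_scheme \<Rightarrow> ('a \<Rightarrow> 'b) \<Rightarrow> bool" where
  "mt_embedding N M h \<longleftrightarrow> mt_morphism N M h \<and>
     h ` carrier N = carrier M \<and> h ` opens N = opens M"

definition mt_compactification ::
  "('b, 'd) mt_struct_scheme \<Rightarrow> ('a, 'c) mt_struct_scheme \<Rightarrow> ('a \<Rightarrow> 'b) \<Rightarrow> bool" where
  "mt_compactification M N h \<longleftrightarrow>
     compact_mt_algebra N \<and> dense_mt_morphism N M h \<and> mt_embedding N M h"

definition space_compactification :: "'a topology \<Rightarrow> 'b topology \<Rightarrow> ('a \<Rightarrow> 'b) \<Rightarrow> bool" where
  "space_compactification X Y f \<longleftrightarrow>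
     compact_space Y \<and> embedding_map X Y f \<and> Y closure_of (f ` topspace X) = topspace Y"

definition powerset_mt :: "'a topology \<Rightarrow> 'a set mt_struct" where
  "powerset_mt X = \<lparr>carrier = Pow (topspace X), eq = (=), le = (\<subseteq>), box = (\<lambda>A. X interior_of A)\<rparr>"

definition inverse_image :: "'a topology \<Rightarrow> ('a \<Rightarrow> 'b) \<Rightarrow> 'b set \<Rightarrow> 'a set" where
  "inverse_image X f B = {x \<in> topspace X. f x \<in> B}"

text \<open>The family of sets below is a topology whenever \<^term>\<open>M\<close> is an MT-algebra; see
  \<open>istopology_atom_space\<close>.\<close>

definition atom_space :: "('a, 'b) mt_struct_scheme \<Rightarrow> 'a topology" where
  "atom_space M = topology (\<lambda>U. \<exists>u \<in> opens M. U = {x \<in> atoms M. x \<sqsubseteq>\<^bsub>M\<^esub> u})"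

definition atom_map ::
  "('a, 'c) gorder_scheme \<Rightarrow> ('b, 'd) gorder_scheme \<Rightarrow> ('a \<Rightarrow> 'b) \<Rightarrow> 'b \<Rightarrow> 'a" where
  "atom_map N M h x = \<Sqinter>\<^bsub>N\<^esub> {b \<in> carrier N. x \<sqsubseteq>\<^bsub>M\<^esub> h b}"

lemma (in complete_boolean_lattice) atom_le_sup:
  assumes x: "x \<in> atoms L" and S: "S \<subseteq> carrier L" and le: "x \<sqsubseteq> \<Squnion>S"
  shows "\<exists>s\<in>S. x \<sqsubseteq> s"
proof (rule ccontr)
  assume neg: "\<not> (\<exists>s\<in>S. x \<sqsubseteq> s)"
  have xc: "x \<in> carrier L" and x0: "x \<noteq> \<bottom>"
    and xmin: "\<And>y. y \<in> carrier L \<Longrightarrow> y \<sqsubseteq> x \<Longrightarrow> y = \<bottom> \<or> y = x"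
    using x by (auto simp: atoms_def)
  obtain c where c: "c \<in> carrier L" "x \<sqinter> c = \<bottom>" "x \<squnion> c = \<top>"
    using complement_exists[OF xc] by (auto simp: is_complement_def)
  have "s \<sqsubseteq> c" if s: "s \<in> S" for s
  proof -
    have sc: "s \<in> carrier L" using s S by auto
    have mc: "s \<sqinter> x \<in> carrier L" using sc xc by simp
    have "s \<sqinter> x \<noteq> x" using neg s meet_left[OF sc xc] by auto
    then have 1: "s \<sqinter> x = \<bottom>" using xmin[OF mc meet_right[OF sc xc]] by simp
    have "s = \<top> \<sqinter> s" using top_meet[OF sc] by (simp add: eq_is_equal)
    also have "\<dots> = s \<sqinter> (x \<squnion> c)" using c(3) meet_comm[of L s] by simp
    also have "\<dots> = (s \<sqinter> x) \<squnion> (s \<sqinter> c)" by (rule meet_join_distrib[OF sc xc c(1)])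
    also have "\<dots> = s \<sqinter> c"
      using 1 bottom_join[of "s \<sqinter> c"] sc c(1) by (simp add: eq_is_equal)
    finally show ?thesis using le_iff_join[OF sc c(1)] by simp
  qed
  then have "\<Squnion>S \<sqsubseteq> c" using S c(1) by (intro sup_least) (auto simp: Upper_def)
  then have "x \<sqsubseteq> c" using le_trans[OF le _ xc _ c(1)] S by simp
  then have "x = \<bottom>" using c(2) le_iff_join[OF xc c(1)] by simp
  then show False using x0 by simp
qed

context mt_algebra
begin

lemma opens_meet: "\<lbrakk>u \<in> opens M; v \<in> opens M\<rbrakk> \<Longrightarrow> u \<sqinter> v \<in> opens M"
  by (auto simp: opens_def box_meet)

lemma opens_top: "\<top> \<in> opens M"
  by (auto simp: opens_def box_top)

lemma box_mono:
  assumes "a \<in> carrier M" "b \<in> carrier M" "a \<sqsubseteq> b"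
  shows "\<box> a \<sqsubseteq> \<box> b"
proof -
  have "a = a \<sqinter> b" using assms le_iff_join by blast
  then have "\<box> a = \<box> a \<sqinter> \<box> b" using box_meet[OF assms(1,2)] by simp
  then show ?thesis using le_iff_join[of "\<box> a" "\<box> b"] box_closed assms by simp
qed

lemma opens_sup:
  assumes "S \<subseteq> opens M" shows "\<Squnion>S \<in> opens M"
proof -
  have S: "S \<subseteq> carrier M" using assms by (auto simp: opens_def)
  have "\<Squnion>S \<sqsubseteq> \<box> (\<Squnion>S)"
  proof (rule sup_least)
    fix s assume s: "s \<in> S"
    then have "s \<sqsubseteq> \<Squnion>S" using S by (intro sup_upper) auto
    then have "\<box> s \<sqsubseteq> \<box> (\<Squnion>S)" using s S by (intro box_mono) auto
    moreover have "\<box> s = s" using s assms by (auto simp: opens_def)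
    ultimately show "s \<sqsubseteq> \<box> (\<Squnion>S)" by simp
  qed (use S box_closed in auto)
  then have "\<box> (\<Squnion>S) = \<Squnion>S"
    using S box_closed box_le by (intro le_antisym) auto
  then show ?thesis using S by (auto simp: opens_def)
qed

lemma istopology_atom_space:
  "istopology (\<lambda>U. \<exists>u \<in> opens M. U = {x \<in> atoms M. x \<sqsubseteq> u})"
  unfolding istopology_def
proof (intro conjI allI impI)
  fix U V
  assume "\<exists>u \<in> opens M. U = {x \<in> atoms M. x \<sqsubseteq> u}" "\<exists>u \<in> opens M. V = {x \<in> atoms M. x \<sqsubseteq> u}"
  then obtain u v where u: "u \<in> opens M" "U = {x \<in> atoms M. x \<sqsubseteq> u}"
    and v: "v \<in> opens M" "V = {x \<in> atoms M. x \<sqsubseteq> v}" by blast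
  have uc: "u \<in> carrier M" "v \<in> carrier M" using u v by (auto simp: opens_def)
  have "U \<inter> V = {x \<in> atoms M. x \<sqsubseteq> u \<sqinter> v}"
  proof -
    have "x \<sqsubseteq> u \<sqinter> v \<longleftrightarrow> x \<sqsubseteq> u \<and> x \<sqsubseteq> v" if "x \<in> atoms M" for x
    proof -
      have xc: "x \<in> carrier M" using that by (auto simp: atoms_def)
      have uv: "u \<sqinter> v \<in> carrier M" using uc by simp
      show ?thesis
        using meet_le[OF _ _ uc xc] le_trans[OF _ meet_left[OF uc] xc uv uc(1)]
          le_trans[OF _ meet_right[OF uc] xc uv uc(2)] by iprover
    qed
    then show ?thesis unfolding u(2) v(2) by auto
  qed
  then show "\<exists>u \<in> opens M. U \<inter> V = {x \<in> atoms M. x \<sqsubseteq> u}"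
    by (rule bexI) (rule opens_meet[OF u(1) v(1)])
next
  fix K
  assume K: "\<forall>U\<in>K. \<exists>u \<in> opens M. U = {x \<in> atoms M. x \<sqsubseteq> u}"
  define S where "S = {u \<in> opens M. {x \<in> atoms M. x \<sqsubseteq> u} \<in> K}"
  have S: "S \<subseteq> opens M" "S \<subseteq> carrier M" by (auto simp: S_def opens_def)
  have "\<Union>K = {x \<in> atoms M. x \<sqsubseteq> \<Squnion>S}"
  proof (intro equalityI subsetI)
    fix x assume "x \<in> \<Union>K"
    then obtain u where u: "u \<in> S" "x \<in> atoms M" "x \<sqsubseteq> u" using K by (auto simp: S_def)
    have "u \<sqsubseteq> \<Squnion>S" using u S by (intro sup_upper) auto
    then have "x \<sqsubseteq> \<Squnion>S"
      using u S by (intro le_trans[of x u "\<Squnion>S"]) (auto simp: atoms_def)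
    then show "x \<in> {x \<in> atoms M. x \<sqsubseteq> \<Squnion>S}" using u by auto
  next
    fix x assume "x \<in> {x \<in> atoms M. x \<sqsubseteq> \<Squnion>S}"
    then have x: "x \<in> atoms M" "x \<sqsubseteq> \<Squnion>S" by auto
    from atom_le_sup[OF x(1) S(2) x(2)] obtain s where s: "s \<in> S" "x \<sqsubseteq> s" ..
    show "x \<in> \<Union>K"
    proof (rule UnionI)
      show "{x \<in> atoms M. x \<sqsubseteq> s} \<in> K" using s(1) by (simp add: S_def)
      show "x \<in> {x \<in> atoms M. x \<sqsubseteq> s}" using x(1) s(2) by simp
    qed
  qed
  then show "\<exists>u \<in> opens M. \<Union>K = {x \<in> atoms M. x \<sqsubseteq> u}"
    by (rule bexI) (rule opens_sup[OF S(1)])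
qed

lemma openin_atom_space:
  "openin (atom_space M) U \<longleftrightarrow> (\<exists>u \<in> opens M. U = {x \<in> atoms M. x \<sqsubseteq> u})"
  unfolding atom_space_def topology_inverse'[OF istopology_atom_space] ..

lemma topspace_atom_space: "topspace (atom_space M) = atoms M"
proof
  obtain u where "topspace (atom_space M) = {x \<in> atoms M. x \<sqsubseteq> u}"
    using openin_topspace[of "atom_space M", unfolded openin_atom_space] by (elim bexE)
  moreover have "{x \<in> atoms M. x \<sqsubseteq> u} \<subseteq> atoms M" by (rule Collect_restrict)
  ultimately show "topspace (atom_space M) \<subseteq> atoms M" by simp
  have "{x \<in> atoms M. x \<sqsubseteq> \<top>} = atoms M" by (auto simp: atoms_def)
  then have "openin (atom_space M) (atoms M)"
    using opens_top openin_atom_space by metis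
  then show "atoms M \<subseteq> topspace (atom_space M)" by (rule openin_subset)
qed

end

lemma powerset_mt_simps [simp]:
  "carrier (powerset_mt X) = Pow (topspace X)"
  "eq (powerset_mt X) = (=)"
  "le (powerset_mt X) = (\<subseteq>)"
  "box (powerset_mt X) A = X interior_of A"
  by (simp_all add: powerset_mt_def)

lemma least_powerset_mt:
  assumes "A \<subseteq> Pow (topspace X)"
  shows "least (powerset_mt X) (\<Union>A) (Upper (powerset_mt X) A)"
proof -
  have "Upper (powerset_mt X) A = {B. \<Union>A \<subseteq> B \<and> B \<subseteq> topspace X}"
    using assms by (simp add: Upper_def) blast
  then show ?thesis using assms by (auto simp: least_def)
qed

lemma greatest_powerset_mt:
  assumes "A \<subseteq> Pow (topspace X)"
  shows "greatest (powerset_mt X) (topspace X \<inter> \<Inter>A) (Lower (powerset_mt X) A)"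
proof -
  have "Lower (powerset_mt X) A = {B. B \<subseteq> topspace X \<inter> \<Inter>A}"
    using assms by (simp add: Lower_def) blast
  then show ?thesis by (auto simp: greatest_def)
qed

lemma complete_lattice_powerset_mt: "complete_lattice (powerset_mt X)"
proof -
  interpret partial_order "powerset_mt X" by unfold_locales auto
  show ?thesis
    by (rule complete_latticeI)
      (metis least_powerset_mt powerset_mt_simps(1), metis greatest_powerset_mt powerset_mt_simps(1))
qed

lemma powerset_mt_sup:
  assumes "A \<subseteq> Pow (topspace X)" shows "\<Squnion>\<^bsub>powerset_mt X\<^esub> A = \<Union>A"
proof -
  interpret complete_lattice "powerset_mt X" by (rule complete_lattice_powerset_mt)
  show ?thesis
    by (rule supI) (use least_unique[OF _ least_powerset_mt[OF assms]] assms in simp_all)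
qed

lemma powerset_mt_inf:
  assumes "A \<subseteq> Pow (topspace X)" shows "\<Sqinter>\<^bsub>powerset_mt X\<^esub> A = topspace X \<inter> \<Inter>A"
proof -
  interpret complete_lattice "powerset_mt X" by (rule complete_lattice_powerset_mt)
  show ?thesis
    by (rule infI) (use greatest_unique[OF _ greatest_powerset_mt[OF assms]] assms in simp_all)
qed

lemma powerset_mt_ops:
  "\<lbrakk>A \<subseteq> topspace X; B \<subseteq> topspace X\<rbrakk> \<Longrightarrow> A \<squnion>\<^bsub>powerset_mt X\<^esub> B = A \<union> B"
  "\<lbrakk>A \<subseteq> topspace X; B \<subseteq> topspace X\<rbrakk> \<Longrightarrow> A \<sqinter>\<^bsub>powerset_mt X\<^esub> B = A \<inter> B"
  by (auto simp: join_def meet_def powerset_mt_sup powerset_mt_inf)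

lemma powerset_mt_top: "\<top>\<^bsub>powerset_mt X\<^esub> = topspace X"
proof -
  interpret complete_lattice "powerset_mt X" by (rule complete_lattice_powerset_mt)
  show ?thesis using top_closed top_higher[of "topspace X"] by auto
qed

lemma powerset_mt_bottom: "\<bottom>\<^bsub>powerset_mt X\<^esub> = {}"
proof -
  interpret complete_lattice "powerset_mt X" by (rule complete_lattice_powerset_mt)
  show ?thesis using bottom_lower[of "{}"] by auto
qed

lemma mt_algebra_powerset_mt: "mt_algebra (powerset_mt X)"
proof -
  interpret complete_lattice "powerset_mt X" by (rule complete_lattice_powerset_mt)
  show ?thesis
  proof
    fix A B C
    assume "A \<in> carrier (powerset_mt X)" "B \<in> carrier (powerset_mt X)" "C \<in> carrier (powerset_mt X)"
    then have "A \<subseteq> topspace X" "B \<subseteq> topspace X" "C \<subseteq> topspace X" by auto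
    moreover from this have "B \<union> C \<subseteq> topspace X" "A \<inter> B \<subseteq> topspace X" "A \<inter> C \<subseteq> topspace X" by auto
    ultimately show "A \<sqinter>\<^bsub>powerset_mt X\<^esub> (B \<squnion>\<^bsub>powerset_mt X\<^esub> C) =
        (A \<sqinter>\<^bsub>powerset_mt X\<^esub> B) \<squnion>\<^bsub>powerset_mt X\<^esub> (A \<sqinter>\<^bsub>powerset_mt X\<^esub> C)"
      by (simp add: powerset_mt_ops Int_Un_distrib)
  next
    fix A assume "A \<in> carrier (powerset_mt X)"
    then show "\<exists>B. is_complement (powerset_mt X) A B"
      by (intro exI[of _ "topspace X - A"])
        (auto simp: is_complement_def powerset_mt_ops powerset_mt_top powerset_mt_bottom)
  next
    show "\<box>\<^bsub>powerset_mt X\<^esub> \<top>\<^bsub>powerset_mt X\<^esub> = \<top>\<^bsub>powerset_mt X\<^esub>"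
      by (simp add: powerset_mt_top)
  next
    fix A B assume "A \<in> carrier (powerset_mt X)" "B \<in> carrier (powerset_mt X)"
    then show "\<box>\<^bsub>powerset_mt X\<^esub> (A \<sqinter>\<^bsub>powerset_mt X\<^esub> B) =
        \<box>\<^bsub>powerset_mt X\<^esub> A \<sqinter>\<^bsub>powerset_mt X\<^esub> \<box>\<^bsub>powerset_mt X\<^esub> B"
      by (simp add: powerset_mt_ops interior_of_subset_topspace interior_of_Int)
  qed (auto simp: interior_of_subset_topspace interior_of_subset)
qed

lemma opens_powerset_mt: "opens (powerset_mt X) = {U. openin X U}"
proof -
  have "U \<subseteq> topspace X \<and> U = X interior_of U \<longleftrightarrow> openin X U" for U
    using interior_of_eq[of X U] openin_subset[of X U] by metis
  then show ?thesis by (simp add: opens_def)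
qed

end

theory Submission
  imports Defs
begin

text \<open>
  A continuous map \<open>f\<close> is an embedding iff it is injective and every open set of \<open>X\<close> is the
  preimage of an open set of \<open>Y\<close>; these two conditions say that \<open>f\<inverse>\<close> is onto on the powersets
  and on the opens. This gives (1). For (2), sending an element to the set of atoms below it
  identifies a spatial algebra \<open>M\<close> with the powerset algebra of its space of atoms. The
  adjunction defining \<open>at(h)\<close> says that under these identifications \<open>h\<close> becomes the inverse image
  under \<open>at(h)\<close>, so that (2) is an instance of (1).
\<close>

section \<open>Spaces and their powerset algebras\<close>

text \<open>For an embedding, \<open>f\<close> U\<open>is open in the image, hence the trace on the
  image of some
  open\<close>V\<open>. Conversely,\<close>f\<open>is open onto its image because\<close>f
  \<open>U\<close> is the trace of \<open>V\<close>, and a continuous open bijection is a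
  homeomorphism.\<close>

lemma embedding_map_iff_inverse_image:
  assumes "continuous_map X Y f"
  shows "embedding_map X Y f \<longleftrightarrow>
    inj_on f (topspace X) \<and> (\<forall>U. openin X U \<longrightarrow> (\<exists>V. openin Y V \<and> inverse_image X f V = U))"
proof
  assume "embedding_map X Y f"
  then have hom: "homeomorphic_map X (subtopology Y (f ` topspace X)) f"
    by (simp add: embedding_map_def)
  have inj: "inj_on f (topspace X)"
    using hom by (simp add: homeomorphic_map_def)
  have "\<exists>V. openin Y V \<and> inverse_image X f V = U" if U: "openin X U" for U
  proof -
    have "openin (subtopology Y (f ` topspace X)) (f ` U)"
      using hom U homeomorphic_imp_open_map open_map_def by blast
    then obtain V where V: "openin Y V" "f ` U = V \<inter> f ` topspace X"
      by (auto simp: openin_subtopology)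
    have "inverse_image X f V = U"
      using V(2) inj openin_subset[OF U] by (fastforce simp: inverse_image_def inj_on_def)
    with V(1) show ?thesis by blast
  qed
  with inj show "inj_on f (topspace X) \<and>
      (\<forall>U. openin X U \<longrightarrow> (\<exists>V. openin Y V \<and> inverse_image X f V = U))" by blast
next
  assume R: "inj_on f (topspace X) \<and>
    (\<forall>U. openin X U \<longrightarrow> (\<exists>V. openin Y V \<and> inverse_image X f V = U))"
  have "open_map X (subtopology Y (f ` topspace X)) f"
    unfolding open_map_def
  proof (intro allI impI)
    fix U assume "openin X U"
    then obtain V where V: "openin Y V" "inverse_image X f V = U" using R by blast
    then have "f ` U = V \<inter> f ` topspace X" by (auto simp: inverse_image_def)
    then show "openin (subtopology Y (f ` topspace X)) (f ` U)"
      using V(1) by (auto simp: openin_subtopology)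
  qed
  then have "homeomorphic_map X (subtopology Y (f ` topspace X)) f"
    using assms R continuous_map_image_subset_topspace[OF assms]
    by (intro bijective_open_imp_homeomorphic_map)
      (auto simp: continuous_map_in_subtopology topspace_subtopology)
  then show "embedding_map X Y f" by (simp add: embedding_map_def)
qed

lemma inverse_image_onto_Pow_iff:
  assumes "f \<in> topspace X \<rightarrow> topspace Y"
  shows "inverse_image X f ` Pow (topspace Y) = Pow (topspace X) \<longleftrightarrow> inj_on f (topspace X)"
proof
  assume onto: "inverse_image X f ` Pow (topspace Y) = Pow (topspace X)"
  show "inj_on f (topspace X)"
  proof (rule inj_onI)
    fix x y assume xy: "x \<in> topspace X" "y \<in> topspace X" "f x = f y"
    \<comment> \<open>A preimage contains, with \<open>x\<close>, every point that has the same
      image; so once \<open>{x}\<close> is a preimage, \<open>y\<close> must be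
      \<open>x\<close>.\<close>
    have "{x} \<in> inverse_image X f ` Pow (topspace Y)" using onto xy(1) by blast
    then obtain B where "inverse_image X f B = {x}" by auto
    moreover from this have "f x \<in> B" by (auto simp: inverse_image_def)
    then have "y \<in> inverse_image X f B" using xy by (simp add: inverse_image_def)
    ultimately show "x = y" by simp
  qed
next
  assume inj: "inj_on f (topspace X)"
  show "inverse_image X f ` Pow (topspace Y) = Pow (topspace X)"
  proof (intro equalityI subsetI)
    fix A assume A: "A \<in> Pow (topspace X)"
    then have "A = inverse_image X f (f ` A)"
      using inj by (auto simp: inverse_image_def inj_on_def)
    moreover have "f ` A \<in> Pow (topspace Y)" using A assms by auto
    ultimately show "A \<in> inverse_image X f ` Pow (topspace Y)" by blast
  qed (auto simp: inverse_image_def)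
qed

text \<open>Preimages commute with unions, intersections and complements. The condition on
  \<open>box\<close> is where continuity enters: the preimage of the interior is an open subset of
  the preimage, so it lies in the interior of the preimage.\<close>

lemma mt_morphism_inverse_image:
  assumes "continuous_map X Y f"
  shows "mt_morphism (powerset_mt Y) (powerset_mt X) (inverse_image X f)"
proof -
  have f: "f x \<in> topspace Y" if "x \<in> topspace X" for x
    using assms that by (auto simp: continuous_map_def)
  have sub: "inverse_image X f B \<subseteq> topspace X" for B
    by (auto simp: inverse_image_def)
  have "sup_pres (powerset_mt Y) (powerset_mt X) (inverse_image X f)"
    unfolding sup_pres_def
  proof (intro conjI allI impI complete_lattice_powerset_mt)
    fix A assume "A \<subseteq> carrier (powerset_mt Y)"
    moreover have "inverse_image X f ` A \<subseteq> Pow (topspace X)" using sub by auto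
    ultimately show "inverse_image X f (\<Squnion>\<^bsub>powerset_mt Y\<^esub> A) =
        \<Squnion>\<^bsub>powerset_mt X\<^esub> (inverse_image X f ` A)"
      by (simp add: powerset_mt_sup) (auto simp: inverse_image_def)
  qed
  moreover have "inf_pres (powerset_mt Y) (powerset_mt X) (inverse_image X f)"
    unfolding inf_pres_def
  proof (intro conjI allI impI complete_lattice_powerset_mt)
    fix A assume "A \<subseteq> carrier (powerset_mt Y)"
    moreover have "inverse_image X f ` A \<subseteq> Pow (topspace X)" using sub by auto
    ultimately show "inverse_image X f (\<Sqinter>\<^bsub>powerset_mt Y\<^esub> A) =
        \<Sqinter>\<^bsub>powerset_mt X\<^esub> (inverse_image X f ` A)"
      \<comment> \<open>The fact \<open>f\<close> covers the empty family, whose infimum is all of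
        \<open>topspace Y\<close>.\<close>
      using f by (simp add: powerset_mt_inf) (auto simp: inverse_image_def)
  qed
  moreover have "is_complement (powerset_mt X) (inverse_image X f A) (inverse_image X f B)"
    if "is_complement (powerset_mt Y) A B" for A B
  proof -
    from that have "A \<subseteq> topspace Y" "B \<subseteq> topspace Y" "A \<inter> B = {}" "A \<union> B = topspace Y"
      by (auto simp: is_complement_def powerset_mt_ops powerset_mt_top powerset_mt_bottom)
    then have "inverse_image X f A \<inter> inverse_image X f B = {}"
      "inverse_image X f A \<union> inverse_image X f B = topspace X"
      using f by (auto simp: inverse_image_def)
    then show ?thesis
      using sub by (simp add: is_complement_def powerset_mt_ops powerset_mt_top powerset_mt_bottom)
  qed
  moreover have "inverse_image X f (Y interior_of A) \<subseteq> X interior_of (inverse_image X f A)" for A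
  proof (rule interior_of_maximal)
    show "inverse_image X f (Y interior_of A) \<subseteq> inverse_image X f A"
      using interior_of_subset[of Y A] by (auto simp: inverse_image_def)
    show "openin X (inverse_image X f (Y interior_of A))"
      unfolding inverse_image_def by (rule openin_continuous_map_preimage[OF assms openin_interior_of])
  qed
  ultimately show ?thesis
    using sub by (auto simp: mt_morphism_def complete_boolean_hom_def mt_algebra_powerset_mt)
qed

text \<open>A subfamily \<open>T\<close> of \<open>S\<close> is again a subset of \<open>A\<close>,
  so the equivalence may be applied to the cover and to its finite subcover alike. It serves to
  exchange suprema for unions in statements of compactness.\<close>

lemma finite_subcover_cong:
  assumes "\<And>S. S \<subseteq> A \<Longrightarrow> P S \<longleftrightarrow> Q S"
  shows "(\<forall>S \<subseteq> A. P S \<longrightarrow> (\<exists>T. finite T \<and> T \<subseteq> S \<and> P T)) \<longleftrightarrow>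
    (\<forall>S \<subseteq> A. Q S \<longrightarrow> (\<exists>T. finite T \<and> T \<subseteq> S \<and> Q T))"
  using assms by (meson subset_trans)

text \<open>Brings compactness of a space into the quantifier form of
  \<open>compact_mt_algebra\<close>.\<close>

lemma compact_space_iff_subset:
  "compact_space X \<longleftrightarrow>
    (\<forall>S \<subseteq> {U. openin X U}. \<Union>S = topspace X \<longrightarrow>
      (\<exists>T. finite T \<and> T \<subseteq> S \<and> \<Union>T = topspace X))"
proof -
  have "(\<forall>U\<in>S. openin X U) \<longleftrightarrow> S \<subseteq> {U. openin X U}" for S by blast
  then show ?thesis unfolding compact_space by (simp add: imp_conjL)
qed

lemma compact_powerset_mt: "compact_mt_algebra (powerset_mt X) \<longleftrightarrow> compact_space X"
proof -
  have sup: "\<Squnion>\<^bsub>powerset_mt X\<^esub> S = topspace X \<longleftrightarrow> \<Union>S = topspace X" if "S \<subseteq> {U. openin X U}" for S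
    using that openin_subset by (subst powerset_mt_sup) blast+
  have "(\<forall>S \<subseteq> {U. openin X U}. \<Squnion>\<^bsub>powerset_mt X\<^esub> S = topspace X \<longrightarrow>
        (\<exists>T. finite T \<and> T \<subseteq> S \<and> \<Squnion>\<^bsub>powerset_mt X\<^esub> T = topspace X)) \<longleftrightarrow> compact_space X"
    unfolding compact_space_iff_subset by (rule finite_subcover_cong) (rule sup)
  then show ?thesis
    by (simp only: compact_mt_algebra_def opens_powerset_mt powerset_mt_top
        mt_algebra_powerset_mt simp_thms)
qed

text \<open>The preimage of \<open>V\<close> is empty exactly when \<open>V\<close> misses the image
  of \<open>f\<close>, and the image is dense exactly when it meets every nonempty open set.\<close>

lemma dense_inverse_image_iff:
  assumes "continuous_map X Y f"
  shows "dense_mt_morphism (powerset_mt Y) (powerset_mt X) (inverse_image X f) \<longleftrightarrow>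
    Y closure_of (f ` topspace X) = topspace Y"
  using mt_morphism_inverse_image[OF assms]
  unfolding dense_mt_morphism_def opens_powerset_mt powerset_mt_bottom dense_intersects_open
  by (auto simp: inverse_image_def)

lemma mt_embedding_inverse_image_iff:
  assumes "continuous_map X Y f"
  shows "mt_embedding (powerset_mt Y) (powerset_mt X) (inverse_image X f) \<longleftrightarrow> embedding_map X Y f"
proof -
  have "openin X (inverse_image X f V)" if "openin Y V" for V
    unfolding inverse_image_def by (rule openin_continuous_map_preimage[OF assms that])
  \<comment> \<open>Continuity gives one inclusion between the two families of open sets, so their
    equality amounts to the other.\<close>
  then have "inverse_image X f ` {V. openin Y V} = {U. openin X U} \<longleftrightarrow>
      (\<forall>U. openin X U \<longrightarrow> (\<exists>V. openin Y V \<and> inverse_image X f V = U))"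
    unfolding set_eq_subset[of "inverse_image X f ` _"] image_subset_iff subset_iff[of "{U. openin X U}"]
    by (simp add: image_iff) metis
  then show ?thesis
    using mt_morphism_inverse_image[OF assms] assms
    by (simp add: mt_embedding_def opens_powerset_mt embedding_map_iff_inverse_image[OF assms]
        inverse_image_onto_Pow_iff continuous_map_def)
qed

lemma space_compactification_iff_mt_compactification:
  assumes "continuous_map X Y f"
  shows "space_compactification X Y f \<longleftrightarrow>
    mt_compactification (powerset_mt X) (powerset_mt Y) (inverse_image X f)"
  unfolding space_compactification_def mt_compactification_def compact_powerset_mt
    dense_inverse_image_iff[OF assms] mt_embedding_inverse_image_iff[OF assms]
  by blast

section \<open>Spatial algebras and their spaces of atoms\<close>

text \<open>The representation of an algebra by sets of atoms. On the opens of an MT-algebra its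
  values are the open sets of \<open>atom_space\<close>.\<close>

definition atoms_below :: "('a, 'b) gorder_scheme \<Rightarrow> 'a \<Rightarrow> 'a set" where
  "atoms_below L a = {x \<in> atoms L. x \<sqsubseteq>\<^bsub>L\<^esub> a}"

context complete_boolean_lattice
begin

lemma atom_closed: "x \<in> atoms L \<Longrightarrow> x \<in> carrier L"
  by (simp add: atoms_def)

text \<open>Atoms are completely join-prime by \<open>atom_le_sup\<close>, which gives the inclusion
  into the union; the other one is transitivity.\<close>

lemma atoms_below_sup:
  assumes "S \<subseteq> carrier L"
  shows "atoms_below L (\<Squnion>S) = \<Union>(atoms_below L ` S)"
proof (intro equalityI subsetI)
  fix x assume "x \<in> \<Union>(atoms_below L ` S)"
  then obtain s where s: "s \<in> S" "x \<in> atoms L" "x \<sqsubseteq> s" by (auto simp: atoms_below_def)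
  have "x \<sqsubseteq> \<Squnion>S"
    using le_trans[OF s(3) sup_upper[OF assms s(1)]] s assms atom_closed by auto
  with s show "x \<in> atoms_below L (\<Squnion>S)" by (simp add: atoms_below_def)
qed (use atom_le_sup[OF _ assms] in \<open>auto simp: atoms_below_def\<close>)

lemma atoms_below_top: "atoms_below L \<top> = atoms L"
  by (auto simp: atoms_below_def atom_closed)

lemma atoms_below_bottom: "atoms_below L \<bottom> = {}"
proof -
  have "x = \<bottom>" if "x \<in> atoms L" "x \<sqsubseteq> \<bottom>" for x
    using that atom_closed by (intro le_antisym) auto
  then show ?thesis by (auto simp: atoms_below_def atoms_def)
qed

text \<open>Let \<open>c\<close> be a complement of \<open>b\<close>. An atom below
  \<open>a \<sqinter> c\<close> would lie below \<open>a\<close>, hence below \<open>b\<close>, and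
  also below \<open>c\<close>, which is impossible. By atomicity \<open>a \<sqinter> c\<close> is
  bottom, and distributivity yields \<open>a = a \<sqinter> b\<close>.\<close>

lemma le_if_atoms_below_subset:
  assumes "atomic L" and a: "a \<in> carrier L" and b: "b \<in> carrier L"
    and sub: "atoms_below L a \<subseteq> atoms_below L b"
  shows "a \<sqsubseteq> b"
proof -
  obtain c where c: "c \<in> carrier L" "b \<sqinter> c = \<bottom>" "b \<squnion> c = \<top>"
    using complement_exists[OF b] by (auto simp: is_complement_def)
  have ac: "a \<sqinter> c \<in> carrier L" using a c by simp
  have "a \<sqinter> c = \<bottom>"
  proof (rule ccontr)
    assume "a \<sqinter> c \<noteq> \<bottom>"
    then obtain x where x: "x \<in> atoms L" "x \<sqsubseteq> a \<sqinter> c"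
      using assms(1) ac by (auto simp: atomic_def)
    note xc = atom_closed[OF x(1)]
    have "x \<sqsubseteq> a" using le_trans[OF x(2) meet_left] xc ac a c by simp
    then have "x \<sqsubseteq> b" using sub x(1) by (auto simp: atoms_below_def)
    moreover have "x \<sqsubseteq> c" using le_trans[OF x(2) meet_right] xc ac a c by simp
    ultimately have "x \<sqsubseteq> \<bottom>" using meet_le[OF _ _ b c(1) xc] c(2) by simp
    then show False using x(1) atoms_below_bottom by (auto simp: atoms_below_def)
  qed
  have "a = a \<sqinter> (b \<squnion> c)"
    using top_meet[OF a] c(3) meet_comm[of L a] by (simp add: eq_is_equal)
  also have "\<dots> = (a \<sqinter> b) \<squnion> (a \<sqinter> c)" by (rule meet_join_distrib[OF a b c(1)])
  also have "\<dots> = a \<sqinter> b"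
    using \<open>a \<sqinter> c = \<bottom>\<close> bottom_join[of "a \<sqinter> b"] join_comm[of L _ \<bottom>] a b
    by (simp add: eq_is_equal)
  finally show ?thesis using le_iff_join[OF a b] by simp
qed

lemma inj_on_atoms_below: "atomic L \<Longrightarrow> inj_on (atoms_below L) (carrier L)"
  using le_if_atoms_below_subset by (intro inj_onI le_antisym) auto

text \<open>A set of atoms is recovered from its supremum: \<open>atoms_below\<close> turns the
  supremum into a union, and the only atom below an atom is that atom itself.\<close>

lemma atoms_below_image_carrier: "atoms_below L ` carrier L = Pow (atoms L)"
proof (intro equalityI subsetI)
  fix A assume "A \<in> Pow (atoms L)"
  then have A: "A \<subseteq> atoms L" "A \<subseteq> carrier L" using atom_closed by auto
  have "atoms_below L x = {x}" if "x \<in> A" for x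
    using that A atoms_below_bottom by (auto simp: atoms_below_def atoms_def)
  then have "atoms_below L (\<Squnion>A) = A" using atoms_below_sup[OF A(2)] by auto
  then show "A \<in> atoms_below L ` carrier L" using A(2) by (metis imageI sup_closed)
qed (auto simp: atoms_below_def)

end

section \<open>Open sets and compactness of the space of atoms\<close>

lemma (in mt_algebra) openin_atom_space_iff:
  "openin (atom_space M) U \<longleftrightarrow> U \<in> atoms_below M ` opens M"
  unfolding openin_atom_space atoms_below_def image_iff ..

lemma (in mt_algebra) atoms_below_image_opens:
  "atoms_below M ` opens M = opens (powerset_mt (atom_space M))"
  by (simp add: opens_powerset_mt openin_atom_space_iff)

text \<open>A family of opens has supremum \<open>\<top>\<close> exactly when the corresponding open
  sets of atoms cover the space, since \<open>atoms_below\<close> preserves suprema and is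
  injective.\<close>

lemma (in mt_algebra) compact_iff_powerset_atom_space:
  assumes "atomic M"
  shows "compact_mt_algebra M \<longleftrightarrow> compact_mt_algebra (powerset_mt (atom_space M))"
proof -
  have inj: "inj_on (atoms_below M) (carrier M)" by (rule inj_on_atoms_below[OF assms])
  have sup: "\<Squnion>S = \<top> \<longleftrightarrow> \<Union>(atoms_below M ` S) = atoms M" if "S \<subseteq> opens M" for S
  proof -
    have S: "S \<subseteq> carrier M" using that by (auto simp: opens_def)
    show ?thesis
      unfolding atoms_below_sup[OF S, symmetric] atoms_below_top[symmetric]
      using inj_on_eq_iff[OF inj sup_closed[OF S] top_closed] by simp
  qed
  have "compact_mt_algebra M \<longleftrightarrow>
      (\<forall>S \<subseteq> opens M. \<Union>(atoms_below M ` S) = atoms M \<longrightarrow>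
        (\<exists>T. finite T \<and> T \<subseteq> S \<and> \<Union>(atoms_below M ` T) = atoms M))"
    unfolding compact_mt_algebra_def eqTrueI[OF mt_algebra_axioms] simp_thms
    by (rule finite_subcover_cong) (rule sup)
  \<comment> \<open>Families of open sets of atoms are images of families of opens, and a finite
    part of such an image is the image of a finite subfamily.\<close>
  also have "\<dots> \<longleftrightarrow> (\<forall>S \<subseteq> atoms_below M ` opens M. \<Union>S = atoms M \<longrightarrow>
        (\<exists>T. finite T \<and> T \<subseteq> S \<and> \<Union>T = atoms M))" (is "?l \<longleftrightarrow> ?r")
  proof
    assume l: ?l
    show ?r
    proof (intro allI impI)
      fix S assume S: "S \<subseteq> atoms_below M ` opens M" "\<Union>S = atoms M"
      then obtain R where R: "R \<subseteq> opens M" "S = atoms_below M ` R"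
        by (meson subset_imageE)
      then obtain T where "finite T" "T \<subseteq> R" "\<Union>(atoms_below M ` T) = atoms M"
        using l R S(2) by metis
      then show "\<exists>T. finite T \<and> T \<subseteq> S \<and> \<Union>T = atoms M"
        using R(2) by (intro exI[of _ "atoms_below M ` T"]) auto
    qed
  next
    assume r: ?r
    show ?l
    proof (intro allI impI)
      fix S assume S: "S \<subseteq> opens M" "\<Union>(atoms_below M ` S) = atoms M"
      then obtain T where T: "finite T" "T \<subseteq> atoms_below M ` S" "\<Union>T = atoms M"
        using r by (meson image_mono)
      then obtain R where "finite R" "R \<subseteq> S" "T = atoms_below M ` R"
        using finite_subset_image by metis
      then show "\<exists>T. finite T \<and> T \<subseteq> S \<and> \<Union>(atoms_below M ` T) = atoms M"
        using T(3) by metis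
    qed
  qed
  also have "\<dots> \<longleftrightarrow> compact_space (atom_space M)"
    by (simp only: compact_space_iff_subset atoms_below_image_opens opens_powerset_mt
        topspace_atom_space)
  finally show ?thesis by (simp add: compact_powerset_mt)
qed

section \<open>MT-morphisms and the induced maps on atoms\<close>

locale mt_hom = N: mt_algebra N + M: mt_algebra M
  for N :: "('n, 'c) mt_struct_scheme" and M :: "('m, 'd) mt_struct_scheme" +
  fixes h :: "'n \<Rightarrow> 'm"
  assumes mt_morphism: "mt_morphism N M h"
begin

lemma hom_closed: "a \<in> carrier N \<Longrightarrow> h a \<in> carrier M"
  and hom_sup: "A \<subseteq> carrier N \<Longrightarrow> h (\<Squnion>\<^bsub>N\<^esub> A) = \<Squnion>\<^bsub>M\<^esub> (h ` A)"
  and hom_inf: "A \<subseteq> carrier N \<Longrightarrow> h (\<Sqinter>\<^bsub>N\<^esub> A) = \<Sqinter>\<^bsub>M\<^esub> (h ` A)"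
  and hom_complement: "is_complement N a b \<Longrightarrow> is_complement M (h a) (h b)"
  and hom_box: "a \<in> carrier N \<Longrightarrow> h (\<box>\<^bsub>N\<^esub> a) \<sqsubseteq>\<^bsub>M\<^esub> \<box>\<^bsub>M\<^esub> (h a)"
  using mt_morphism
  unfolding mt_morphism_def complete_boolean_hom_def sup_pres_def inf_pres_def Pi_iff
  by blast+

lemma hom_bottom: "h \<bottom>\<^bsub>N\<^esub> = \<bottom>\<^bsub>M\<^esub>"
  using hom_sup[of "{}"] N.weak_sup_empty M.weak_sup_empty
  by (simp add: N.eq_is_equal M.eq_is_equal)

text \<open>The order is expressed by the infimum of a pair, which \<open>h\<close>
  preserves.\<close>

lemma hom_mono:
  assumes "a \<in> carrier N" "b \<in> carrier N" "a \<sqsubseteq>\<^bsub>N\<^esub> b"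
  shows "h a \<sqsubseteq>\<^bsub>M\<^esub> h b"
proof -
  have "a = \<Sqinter>\<^bsub>N\<^esub> {a, b}" using assms N.le_iff_join[of a b] by (simp add: meet_def)
  then have "h a = \<Sqinter>\<^bsub>M\<^esub> {h a, h b}" using hom_inf[of "{a, b}"] assms by simp
  then show ?thesis
    using M.le_iff_join[of "h a" "h b"] hom_closed assms by (simp add: meet_def)
qed

text \<open>On an open \<open>u\<close> the inequality for \<open>box\<close> reads
  \<open>h u \<sqsubseteq> \<box> (h u)\<close>; the reverse one always holds.\<close>

lemma hom_opens:
  assumes "u \<in> opens N"
  shows "h u \<in> opens M"
proof -
  have u: "u \<in> carrier N" "\<box>\<^bsub>N\<^esub> u = u" using assms by (simp_all add: opens_def)
  then have "h u \<sqsubseteq>\<^bsub>M\<^esub> \<box>\<^bsub>M\<^esub> (h u)" using hom_box[of u] by simp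
  then have "h u = \<box>\<^bsub>M\<^esub> (h u)"
    by (rule M.le_antisym) (simp_all add: M.box_le M.box_closed hom_closed u(1))
  then show ?thesis unfolding opens_def using hom_closed[OF u(1)] by blast
qed

lemma atom_map_closed: "atom_map N M h x \<in> carrier N"
  unfolding atom_map_def by (rule N.inf_closed) auto

text \<open>\<open>atom_map\<close> is the left adjoint of \<open>h\<close>. It exists because
  \<open>h\<close> preserves all infima: applying \<open>h\<close> to the infimum that defines it
  gives the unit inequality \<open>x \<sqsubseteq> h (atom_map N M h x)\<close>.\<close>

lemma atom_map_le_iff:
  assumes x: "x \<in> carrier M" and b: "b \<in> carrier N"
  shows "atom_map N M h x \<sqsubseteq>\<^bsub>N\<^esub> b \<longleftrightarrow> x \<sqsubseteq>\<^bsub>M\<^esub> h b"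
proof
  let ?B = "{b \<in> carrier N. x \<sqsubseteq>\<^bsub>M\<^esub> h b}"
  have "x \<sqsubseteq>\<^bsub>M\<^esub> \<Sqinter>\<^bsub>M\<^esub> (h ` ?B)" using x hom_closed by (intro M.inf_greatest) auto
  also have "\<dots> = h (atom_map N M h x)" unfolding atom_map_def by (rule hom_inf[symmetric]) auto
  finally have unit: "x \<sqsubseteq>\<^bsub>M\<^esub> h (atom_map N M h x)" .
  assume "atom_map N M h x \<sqsubseteq>\<^bsub>N\<^esub> b"
  then have "h (atom_map N M h x) \<sqsubseteq>\<^bsub>M\<^esub> h b" by (rule hom_mono[OF atom_map_closed b])
  then show "x \<sqsubseteq>\<^bsub>M\<^esub> h b"
    using M.le_trans[OF unit] hom_closed[OF atom_map_closed] hom_closed[OF b] x by simp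
next
  assume "x \<sqsubseteq>\<^bsub>M\<^esub> h b"
  then show "atom_map N M h x \<sqsubseteq>\<^bsub>N\<^esub> b"
    unfolding atom_map_def using b by (intro N.inf_lower CollectI conjI) auto
qed

text \<open>An atom lies below \<open>h y\<close> or below the image of the complement of \<open>y\<close>.\<close>

lemma atom_map_atom:
  assumes x: "x \<in> atoms M"
  shows "atom_map N M h x \<in> atoms N"
proof -
  let ?p = "atom_map N M h x"
  note xc = M.atom_closed[OF x]
  have "?p \<noteq> \<bottom>\<^bsub>N\<^esub>"
  proof
    assume "?p = \<bottom>\<^bsub>N\<^esub>"
    then have "x \<sqsubseteq>\<^bsub>M\<^esub> \<bottom>\<^bsub>M\<^esub>"
      using atom_map_le_iff[OF xc N.bottom_closed] hom_bottom by simp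
    then show False using x M.atoms_below_bottom by (auto simp: atoms_below_def)
  qed
  moreover have "y = \<bottom>\<^bsub>N\<^esub> \<or> y = ?p" if y: "y \<in> carrier N" "y \<sqsubseteq>\<^bsub>N\<^esub> ?p" for y
  proof -
    obtain c where c: "is_complement N y c" using N.complement_exists[OF y(1)] by blast
    then have cc: "c \<in> carrier N" "y \<sqinter>\<^bsub>N\<^esub> c = \<bottom>\<^bsub>N\<^esub>" by (auto simp: is_complement_def)
    have "\<Squnion>\<^bsub>M\<^esub> {h y, h c} = \<top>\<^bsub>M\<^esub>"
      using hom_complement[OF c] by (simp add: is_complement_def join_def)
    then have "\<exists>s\<in>{h y, h c}. x \<sqsubseteq>\<^bsub>M\<^esub> s"
      using x xc hom_closed y(1) cc(1) by (intro M.atom_le_sup) auto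
    then consider "?p \<sqsubseteq>\<^bsub>N\<^esub> y" | "?p \<sqsubseteq>\<^bsub>N\<^esub> c"
      using atom_map_le_iff[OF xc] y(1) cc(1) by auto
    then show ?thesis
    proof cases
      case 1
      then show ?thesis using N.le_antisym[OF y(2)] y(1) atom_map_closed by blast
    next
      case 2
      \<comment> \<open>Now \<open>y\<close> lies below its own complement, so it is bottom.\<close>
      then have "y \<sqsubseteq>\<^bsub>N\<^esub> c" using N.le_trans[OF y(2)] y(1) cc(1) atom_map_closed by blast
      then show ?thesis using N.le_iff_join[OF y(1) cc(1)] cc(2) by simp
    qed
  qed
  ultimately show ?thesis
    unfolding atoms_def using atom_map_closed by (intro CollectI conjI ballI impI)
qed

text \<open>Naturality of the representation: this is the adjunction read at atoms, which
  \<open>atom_map\<close> sends to atoms.\<close>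

lemma atoms_below_hom:
  assumes "b \<in> carrier N"
  shows "atoms_below M (h b) = inverse_image (atom_space M) (atom_map N M h) (atoms_below N b)"
proof -
  have "x \<sqsubseteq>\<^bsub>M\<^esub> h b \<longleftrightarrow> atom_map N M h x \<in> atoms_below N b" if "x \<in> atoms M" for x
    using atom_map_le_iff[OF M.atom_closed[OF that] assms] atom_map_atom[OF that]
    by (simp add: atoms_below_def)
  then show ?thesis
    unfolding inverse_image_def M.topspace_atom_space
    by (simp only: atoms_below_def[of M] cong: conj_cong)
qed

text \<open>By naturality the preimage of the open set given by \<open>v\<close> is the one given by
  \<open>h v\<close>, and \<open>h v\<close> is open.\<close>

lemma continuous_map_atom_map: "continuous_map (atom_space M) (atom_space N) (atom_map N M h)"
  unfolding continuous_map_def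
proof (intro conjI allI impI)
  fix V assume "openin (atom_space N) V"
  then obtain v where v: "v \<in> opens N" "V = atoms_below N v"
    unfolding N.openin_atom_space_iff by (rule imageE)
  have "v \<in> carrier N" using v(1) by (simp add: opens_def)
  then have "{x \<in> topspace (atom_space M). atom_map N M h x \<in> V} = atoms_below M (h v)"
    using atoms_below_hom[of v] v(2) by (simp add: inverse_image_def)
  then show "openin (atom_space M) {x \<in> topspace (atom_space M). atom_map N M h x \<in> V}"
    using hom_opens[OF v(1)] by (simp add: M.openin_atom_space_iff)
qed (use M.topspace_atom_space N.topspace_atom_space atom_map_atom in blast)

text \<open>The maps \<open>atoms_below\<close> are bijections that respect opens, and by naturality
  they carry \<open>h\<close> to the inverse image under \<open>atom_map\<close>. Compactness,
  density and the two surjectivity conditions are transported one at a time.\<close>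

lemma mt_compactification_iff_powerset:
  assumes "atomic M" "atomic N"
  shows "mt_compactification M N h \<longleftrightarrow>
    mt_compactification (powerset_mt (atom_space M)) (powerset_mt (atom_space N))
      (inverse_image (atom_space M) (atom_map N M h))"
proof -
  let ?g = "inverse_image (atom_space M) (atom_map N M h)"
  let ?PM = "powerset_mt (atom_space M)" and ?PN = "powerset_mt (atom_space N)"
  note injM = M.inj_on_atoms_below[OF assms(1)] and injN = N.inj_on_atoms_below[OF assms(2)]
  have opens_carrier: "opens N \<subseteq> carrier N" "opens M \<subseteq> carrier M" by (auto simp: opens_def)
  have carr: "carrier ?PN = atoms_below N ` carrier N" "carrier ?PM = atoms_below M ` carrier M"
    by (simp_all add: N.topspace_atom_space M.topspace_atom_space
        N.atoms_below_image_carrier M.atoms_below_image_carrier)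
  have image: "?g ` atoms_below N ` A = atoms_below M ` h ` A" if "A \<subseteq> carrier N" for A
    using atoms_below_hom that by (force simp: image_image intro!: image_cong)
  have bottom: "atoms_below M a = {} \<longleftrightarrow> a = \<bottom>\<^bsub>M\<^esub>" if "a \<in> carrier M" for a
    using inj_on_eq_iff[OF injM that M.bottom_closed] M.atoms_below_bottom by simp
  have bottom': "atoms_below N a = {} \<longleftrightarrow> a = \<bottom>\<^bsub>N\<^esub>" if "a \<in> carrier N" for a
    using inj_on_eq_iff[OF injN that N.bottom_closed] N.atoms_below_bottom by simp
  have morph: "mt_morphism ?PN ?PM ?g"
    by (rule mt_morphism_inverse_image[OF continuous_map_atom_map])
  \<comment> \<open>Both sides of the density condition become emptiness of sets of atoms.\<close>
  have "?g (atoms_below N u) = {} \<longleftrightarrow> h u = \<bottom>\<^bsub>M\<^esub>"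
    and "atoms_below N u = {} \<longleftrightarrow> u = \<bottom>\<^bsub>N\<^esub>" if "u \<in> opens N" for u
    using that atoms_below_hom[of u] bottom[of "h u"] bottom'[of u] hom_closed[of u]
    by (simp_all add: opens_def)
  then have "dense_mt_morphism N M h \<longleftrightarrow> dense_mt_morphism ?PN ?PM ?g"
    by (simp add: dense_mt_morphism_def powerset_mt_bottom mt_morphism morph
        N.atoms_below_image_opens[symmetric])
  moreover have "?g ` carrier ?PN = carrier ?PM \<longleftrightarrow> h ` carrier N = carrier M"
    unfolding carr image[OF subset_refl]
    \<comment> \<open>After naturality both sides are images under \<open>atoms_below M\<close>,
      which injectivity cancels.\<close>
    by (rule inj_on_image_eq_iff[OF injM]) (use hom_closed in blast)+
  moreover have "?g ` opens ?PN = opens ?PM \<longleftrightarrow> h ` opens N = opens M"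
    unfolding N.atoms_below_image_opens[symmetric] M.atoms_below_image_opens[symmetric]
      image[OF opens_carrier(1)]
    by (rule inj_on_image_eq_iff[OF injM]) (use hom_opens opens_carrier in blast)+
  ultimately show ?thesis
    unfolding mt_compactification_def mt_embedding_def
      N.compact_iff_powerset_atom_space[OF assms(2)]
    by (simp only: mt_morphism morph)
qed

end

theorem proposition3p4:
  fixes X :: "'x topology" and Y :: "'y topology" and f :: "'x \<Rightarrow> 'y"
    and M :: "'m mt_struct" and N :: "'n mt_struct" and h :: "'n \<Rightarrow> 'm"
  assumes "continuous_map X Y f"
    and "spatial_mt_algebra M" and "spatial_mt_algebra N"
    and "mt_morphism N M h"
  shows "(space_compactification X Y f \<longleftrightarrow>
            mt_compactification (powerset_mt X) (powerset_mt Y) (inverse_image X f)) \<and>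
         (mt_compactification M N h \<longleftrightarrow>
            space_compactification (atom_space M) (atom_space N) (atom_map N M h))"
proof
  show "space_compactification X Y f \<longleftrightarrow>
      mt_compactification (powerset_mt X) (powerset_mt Y) (inverse_image X f)"
    by (rule space_compactification_iff_mt_compactification[OF assms(1)])
  have spatial: "mt_algebra N" "mt_algebra M" "atomic M" "atomic N"
    using assms(2,3) by (simp_all add: spatial_mt_algebra_def)
  have hom: "mt_hom N M h"
    by (intro mt_hom.intro mt_hom_axioms.intro spatial assms(4))
  show "mt_compactification M N h \<longleftrightarrow>
      space_compactification (atom_space M) (atom_space N) (atom_map N M h)"
    \<comment> \<open>Once \<open>h\<close> is replaced by an inverse image, the claim is the first
      equivalence for the continuous map \<open>atom_map N M h\<close>, read from right to
      left.\<close>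
    unfolding mt_hom.mt_compactification_iff_powerset[OF hom spatial(3,4)]
    by (rule space_compactification_iff_mt_compactification[symmetric,
          OF mt_hom.continuous_map_atom_map[OF hom]])
qed

end
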